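(* For any integers $k \ge 1$ and $1 \le p \le 2^{k^2/4}$ there exists a $k$-connected undirected graph $G=G(k,p)$ with $n=k(p+1)$ nodes such that any $k$-connectivity oracle for $G$ requires at least $p \cdot k^2/4 = \left(1-\frac{1}{p+1}\right)\cdot kn/4$ bits of space. Consequently, a $k$-connectivity oracle for a $k$-connected graph requires $\Omega(kn)$ bits of space.
   Context: For a (directed or undirected) graph $G=(V,E)$ and nodes $s,t\in V$, $\kappa(s,t)=\kappa_G(s,t)$ denotes the maximum number of internally-disjoint $st$-paths in $G$. $G$ is $k$-connected if $\kappa(s,t)\ge k$ for all $(s,t)\in V\times V$. A $k$-connectivity oracle for $G$ is a data structure that, given $s,t\in V$, determines whether $\kappa(s,t)>k$.
   Formalization: The case k=1 (only p=1, n=2, G=K_2, where 0 bits suffice) is excluded from the first claim; G may depend on the oracle's query procedure, since a procedure could hardwire a fixed G; the bound Ω(kn) is stated for n>2k, as it fails for n=k+1. *)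

theory Defs
  imports Complex_Main "Graph_Theory.Graph_Theory"
begin

text \<open>
  Graphs are pair digraphs; \<^locale>\<open>pair_graph\<close> is the locale of finite simple undirected graphs,
  represented by a symmetric irreflexive set of arcs. As there are no parallel arcs, a path is
  determined by its list of vertices.
\<close>

definition inner_verts :: "'a list \<Rightarrow> 'a set" where
  "inner_verts p = set (butlast (tl p))"

definition internally_disjoint_paths ::
  "'a pair_pre_digraph \<Rightarrow> 'a \<Rightarrow> 'a \<Rightarrow> 'a list set \<Rightarrow> bool" where
  "internally_disjoint_paths G s t P \<longleftrightarrow>
     (\<forall>p\<in>P. vpath p (with_proj G) \<and> hd p = s \<and> last p = t) \<and>
     (\<forall>p\<in>P. \<forall>q\<in>P. p \<noteq> q \<longrightarrow> inner_verts p \<inter> inner_verts q = {})"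

text \<open>
  For finite \<open>G\<close> there are only finitely many paths, so the maximum is over a finite set, which
  contains \<open>0\<close> because of the empty family.
\<close>

definition kappa :: "'a pair_pre_digraph \<Rightarrow> 'a \<Rightarrow> 'a \<Rightarrow> nat" where
  "kappa G s t = Max (card ` {P. internally_disjoint_paths G s t P})"

text \<open>
  Pairs with \<open>s = t\<close> are excluded, here and in queries: the only path from \<open>s\<close> to \<open>s\<close> is the
  trivial one, so \<open>kappa G s s = 1\<close>.
\<close>

definition k_connected :: "nat \<Rightarrow> 'a pair_pre_digraph \<Rightarrow> bool" where
  "k_connected k G \<longleftrightarrow>
     (\<forall>s\<in>pverts G. \<forall>t\<in>pverts G. s \<noteq> t \<longrightarrow> k \<le> kappa G s t)"

text \<open>
  A data structure is the bit string \<open>D\<close> that is stored, and its space is \<open>length D\<close>. The query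
  procedure has access only to \<open>D\<close> and to the names of the two query nodes; it is an arbitrary
  function, so no bound on query time or computability is imposed. A lower bound must choose \<open>G\<close>
  depending on \<open>query\<close>: a procedure tailored to one fixed graph would need no stored bits. For
  \<open>k = 1\<close> and two nodes every answer is negative, so there no bits are needed at all.
\<close>

definition k_connectivity_oracle ::
  "(bool list \<Rightarrow> 'a \<Rightarrow> 'a \<Rightarrow> bool) \<Rightarrow> nat \<Rightarrow> 'a pair_pre_digraph \<Rightarrow> bool list \<Rightarrow> bool" where
  "k_connectivity_oracle query k G D \<longleftrightarrow>
     (\<forall>s\<in>pverts G. \<forall>t\<in>pverts G. s \<noteq> t \<longrightarrow> (query D s t \<longleftrightarrow> kappa G s t > k))"

end

theory Submission
  imports Defs
begin

text \<open>
  Arrange the nodes in rows \<open>0, \<dots>, p\<close> of at least \<open>k\<close> nodes each, all rows being cliques and row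
  \<open>0\<close> having exactly \<open>k\<close> nodes. Every row \<open>r > 0\<close> is joined to row \<open>0\<close> only, by a preorder
  \<open>R r\<close> on \<open>{..<k}\<close>: node \<open>(r, i)\<close> is adjacent to \<open>(0, j)\<close> iff \<open>(i, j) \<in> R r\<close>. Reflexivity gives
  \<open>k\<close> disjoint paths between any two nodes, indexed by the columns. Transitivity makes
  \<open>\<kappa>((r, i), (0, j)) > k\<close> equivalent to \<open>(i, j) \<in> R r\<close> for \<open>i \<noteq> j\<close>, so an oracle determines all of
  \<open>R 1, \<dots>, R p\<close>. There are at least \<open>2^(h (k - h) + 1)\<close> preorders on \<open>k \<ge> 2\<close> points, where
  \<open>h = \<lfloor>k / 2\<rfloor>\<close>, and \<open>h (k - h) + 1 \<ge> k^2 / 4\<close> also for odd \<open>k\<close>; hence the bound on the number of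
  bits. Surplus nodes are put into row \<open>p\<close>, which settles all \<open>n > 2 k\<close> when \<open>k \<ge> 2\<close>. For
  \<open>k = 1\<close> an arbitrary matching on the leaves of a star is encoded instead.
\<close>

section \<open>Families of paths\<close>

lemma vwalk_singleton [simp]: "vwalk [x] G \<longleftrightarrow> x \<in> verts G"
  by (simp add: vwalk_def)

lemma vwalk_Cons_Cons [simp]:
  "vwalk (x # y # p) G \<longleftrightarrow> x \<in> verts G \<and> (x, y) \<in> arcs_ends G \<and> vwalk (y # p) G"
  by (auto simp: vwalk_def)

lemma finite_vpaths:
  assumes "finite (verts G)"
  shows "finite {p. vpath p G}"
proof (rule finite_subset)
  show "{p. vpath p G} \<subseteq> {xs. set xs \<subseteq> verts G \<and> distinct xs}"
    by (auto simp: vpath_def vwalk_def)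
  show "finite {xs. set xs \<subseteq> verts G \<and> distinct xs}"
    using assms by (rule finite_subset_distinct)
qed

lemma internally_disjoint_paths_subset:
  "internally_disjoint_paths G s t P \<Longrightarrow> P \<subseteq> {p. vpath p (with_proj G)}"
  by (auto simp: internally_disjoint_paths_def)

lemma finite_internally_disjoint_paths:
  assumes "finite (pverts G)"
  shows "finite {P. internally_disjoint_paths G s t P}"
proof (rule finite_subset)
  show "{P. internally_disjoint_paths G s t P} \<subseteq> Pow {p. vpath p (with_proj G)}"
    by (rule subsetI, rule PowI, rule internally_disjoint_paths_subset, erule CollectD)
  have "finite {p. vpath p (with_proj G)}"
    using assms by (intro finite_vpaths) simp
  then show "finite (Pow {p. vpath p (with_proj G)})"
    by (rule iffD2[OF finite_Pow_iff])
qed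

lemma card_le_kappa:
  assumes "finite (pverts G)" "internally_disjoint_paths G s t P"
  shows "card P \<le> kappa G s t"
  unfolding kappa_def using assms finite_internally_disjoint_paths[OF assms(1)]
  by (intro Max_ge) auto

lemma kappa_leI:
  assumes "finite (pverts G)" "\<And>P. internally_disjoint_paths G s t P \<Longrightarrow> card P \<le> m"
  shows "kappa G s t \<le> m"
  unfolding kappa_def
proof (rule Max.boundedI)
  show "finite (card ` {P. internally_disjoint_paths G s t P})"
    using finite_internally_disjoint_paths[OF assms(1)] by blast
  have "internally_disjoint_paths G s t {}"
    by (simp add: internally_disjoint_paths_def)
  then show "card ` {P. internally_disjoint_paths G s t P} \<noteq> {}"
    by blast
qed (use assms(2) in auto)

text \<open>The family is given by inner vertex lists. Disjointness alone would allow
  \<open>[]\<close> twice, that is, the arc from \<open>s\<close> to \<open>t\<close> counted twice;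
  hence the separate condition \<open>neq\<close>.\<close>

lemma le_kappaI:
  assumes "finite (pverts G)" "finite I" "m \<le> card I"
    and path: "\<And>i. i \<in> I \<Longrightarrow> vpath (s # q i @ [t]) (with_proj G)"
    and disj: "\<And>i j. i \<in> I \<Longrightarrow> j \<in> I \<Longrightarrow> i \<noteq> j \<Longrightarrow> set (q i) \<inter> set (q j) = {}"
    and neq: "\<And>i j. i \<in> I \<Longrightarrow> j \<in> I \<Longrightarrow> i \<noteq> j \<Longrightarrow> q i \<noteq> q j"
  shows "m \<le> kappa G s t"
proof -
  let ?f = "\<lambda>i. s # q i @ [t]"
  have inner: "inner_verts (?f i) = set (q i)" for i
    by (simp add: inner_verts_def)
  have "internally_disjoint_paths G s t (?f ` I)"
    unfolding internally_disjoint_paths_def using path disj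
    by (auto simp: inner simp del: set_append)
  moreover have "card (?f ` I) = card I"
    using neq by (intro card_image) (auto simp: inj_on_def)
  ultimately show ?thesis
    using card_le_kappa[OF assms(1)] assms(3) by fastforce
qed

section \<open>Vertex cuts as upper bounds on \<open>kappa\<close>\<close>

lemma vwalk_hits_cut:
  assumes "vwalk p (with_proj G)" "hd p \<in> C" "last p \<notin> C" "last p \<notin> W"
    and cut: "\<And>u v. (u, v) \<in> parcs G \<Longrightarrow> u \<in> C \<Longrightarrow> v \<in> C \<union> W"
  shows "\<exists>x \<in> set p. x \<in> W"
  using assms(1-4)
proof (induction p rule: induct_list012)
  case (3 x y p)
  then show ?case
    using cut[of x y] by (cases "y \<in> C") auto
qed auto

text \<open>The easy half of Menger's theorem: each path has an inner vertex in \<open>W\<close>,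
  and internal disjointness makes the choice of one injective.\<close>

lemma kappa_le_cut:
  assumes "finite (pverts G)" "finite W" "s \<in> C" "s \<notin> W" "t \<notin> C" "t \<notin> W"
    and cut: "\<And>u v. (u, v) \<in> parcs G \<Longrightarrow> u \<in> C \<Longrightarrow> v \<in> C \<union> W"
  shows "kappa G s t \<le> card W"
proof (rule kappa_leI[OF assms(1)])
  fix P assume P: "internally_disjoint_paths G s t P"
  have "\<exists>x. x \<in> inner_verts p \<inter> W" if "p \<in> P" for p
  proof -
    have p: "vwalk p (with_proj G)" "hd p = s" "last p = t"
      using P that by (auto simp: internally_disjoint_paths_def vpath_def)
    obtain x where x: "x \<in> set p" "x \<in> W"
      using vwalk_hits_cut[of p G C W] p assms(3-6) cut by auto
    have "set p \<subseteq> insert (hd p) (insert (last p) (inner_verts p))"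
    proof (cases p)
      case (Cons a q)
      then show ?thesis
        by (cases q rule: rev_cases) (auto simp: inner_verts_def)
    qed simp
    then show ?thesis
      using x p assms by auto
  qed
  then obtain f where f: "\<And>p. p \<in> P \<Longrightarrow> f p \<in> inner_verts p \<inter> W"
    by metis
  have "inj_on f P"
  proof (rule inj_onI, rule ccontr)
    fix p q assume "p \<in> P" "q \<in> P" "f p = f q" "p \<noteq> q"
    then show False
      using f[of p] f[of q] P by (auto simp: internally_disjoint_paths_def)
  qed
  then show "card P \<le> card W"
    using f assms(2) by (intro card_inj_on_le[of f]) auto
qed

section \<open>Relabelling\<close>

text \<open>Carries block graphs, whose nodes are pairs, over to the node set
  \<open>{..<n}\<close>.\<close>

definition relabel :: "('a \<Rightarrow> 'b) \<Rightarrow> 'a pair_pre_digraph \<Rightarrow> 'b pair_pre_digraph" where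
  "relabel f G = \<lparr>pverts = f ` pverts G, parcs = map_prod f f ` parcs G\<rparr>"

lemma relabel_simps [simp]:
  "pverts (relabel f G) = f ` pverts G" "parcs (relabel f G) = map_prod f f ` parcs G"
  by (simp_all add: relabel_def)

lemma vwalk_arcs_map: "vwalk_arcs (map f p) = map (map_prod f f) (vwalk_arcs p)"
  by (induction p rule: vwalk_arcs.induct) auto

lemma inner_verts_map: "inner_verts (map f p) = f ` inner_verts p"
  by (metis inner_verts_def list.set_map map_butlast map_tl)

lemma inner_verts_subset: "inner_verts p \<subseteq> set p"
  by (cases p) (auto simp: inner_verts_def dest: in_set_butlastD)

lemma kappa_le_relabel:
  assumes "finite (pverts G)" and inj: "inj_on f (pverts G)"
  shows "kappa G s t \<le> kappa (relabel f G) (f s) (f t)"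
proof (rule kappa_leI[OF assms(1)])
  fix P assume P: "internally_disjoint_paths G s t P"
  have p: "set p \<subseteq> pverts G" "p \<noteq> []" "vpath p (with_proj G)" "hd p = s" "last p = t"
    if "p \<in> P" for p
    using that P by (auto simp: internally_disjoint_paths_def vpath_def vwalk_def)
  have "inner_verts (map f p) \<inter> inner_verts (map f q) = {}"
    if "p \<in> P" "q \<in> P" "p \<noteq> q" for p q
  proof -
    have "inner_verts p \<inter> inner_verts q = {}"
      using that P by (auto simp: internally_disjoint_paths_def)
    moreover have "inner_verts p \<subseteq> pverts G" "inner_verts q \<subseteq> pverts G"
      using p(1)[OF that(1)] p(1)[OF that(2)] inner_verts_subset[of p] inner_verts_subset[of q]
      by (meson subset_trans)+
    ultimately show ?thesis
      unfolding inner_verts_map using inj_on_image_Int[OF inj] by (metis image_empty)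
  qed
  moreover have "vpath (map f p) (with_proj (relabel f G))" if "p \<in> P" for p
    using p(1-3)[OF that] inj
    by (auto simp: vpath_def vwalk_def vwalk_arcs_map distinct_map intro: inj_on_subset)
  ultimately have "internally_disjoint_paths (relabel f G) (f s) (f t) (map f ` P)"
    using p by (auto simp: internally_disjoint_paths_def hd_map last_map)
  moreover have "inj_on (map f) P"
    using p(1) inj by (intro inj_onI) (metis inj_on_map_eq_map inj_on_subset le_sup_iff)
  ultimately show "card P \<le> kappa (relabel f G) (f s) (f t)"
    using card_le_kappa[of "relabel f G"] assms(1) by (metis card_image finite_imageI relabel_simps(1))
qed

lemma kappa_relabel:
  assumes "pair_graph G" and inj: "inj_on f (pverts G)" and st: "s \<in> pverts G" "t \<in> pverts G"
  shows "kappa (relabel f G) (f s) (f t) = kappa G s t"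
proof (rule antisym)
  interpret pair_graph G by fact
  let ?g = "inv_into (pverts G) f"
  have g: "?g (f x) = x" if "x \<in> pverts G" for x
    using inj that by simp
  have "relabel ?g (relabel f G) = G"
  proof -
    have "map_prod ?g ?g (map_prod f f e) = e" if "e \<in> parcs G" for e
      using that arc_fst_in_verts[OF that] arc_snd_in_verts[OF that] g by (cases e) auto
    then have "map_prod ?g ?g ` map_prod f f ` parcs G = parcs G"
      by (simp add: image_image)
    then show ?thesis
      using g by (simp add: relabel_def image_image)
  qed
  \<comment> \<open>The inequality for the inverse labelling, which turns \<open>relabel f G\<close>
    back into \<open>G\<close>.\<close>
  then show "kappa (relabel f G) (f s) (f t) \<le> kappa G s t"
    using kappa_le_relabel[of "relabel f G" ?g "f s" "f t"] pair_finite_verts g st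
    by (simp add: inj_on_inv_into)
  show "kappa G s t \<le> kappa (relabel f G) (f s) (f t)"
    using kappa_le_relabel[OF pair_finite_verts inj] .
qed

lemma pair_graphI:
  assumes "finite (pverts G)" "parcs G \<subseteq> pverts G \<times> pverts G" "sym (parcs G)" "irrefl (parcs G)"
  shows "pair_graph G"
proof
  show "finite (parcs G)"
    using assms(1,2) finite_subset by blast
qed (use assms in \<open>auto simp: symmetric_def irrefl_def\<close>)

lemma pair_graph_relabel:
  assumes "pair_graph G" and inj: "inj_on f (pverts G)"
  shows "pair_graph (relabel f G)"
proof -
  interpret pair_graph G by fact
  have sym: "(v, u) \<in> parcs G" if "(u, v) \<in> parcs G" for u v
    using pair_sym_arcs that by (auto simp: symmetric_def sym_def)
  have neq: "f u \<noteq> f v" if "(u, v) \<in> parcs G" for u v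
    using pair_no_loops[OF that] in_arcsD1[OF that] in_arcsD2[OF that] inj by (auto dest: inj_onD)
  show ?thesis
  proof (rule pair_graphI)
    show "parcs (relabel f G) \<subseteq> pverts (relabel f G) \<times> pverts (relabel f G)"
      using in_arcsD1 in_arcsD2 by auto
    show "sym (parcs (relabel f G))"
      using sym by (force intro: symI)
    show "irrefl (parcs (relabel f G))"
      using neq by (force simp: irrefl_def)
  qed (use pair_finite_verts in simp)
qed

section \<open>Counting\<close>

lemma card_short_bool_lists:
  "finite {xs :: bool list. length xs < m}" "card {xs :: bool list. length xs < m} < 2 ^ m"
proof -
  have eq: "{xs :: bool list. length xs < m} = (\<Union>l<m. {xs. set xs \<subseteq> UNIV \<and> length xs = l})"
    by auto
  show fin: "finite {xs :: bool list. length xs < m}"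
    unfolding eq by (intro finite_UN_I finite_lists_length_eq) auto
  have "card {xs :: bool list. length xs < m} \<le> (\<Sum>l<m. card {xs :: bool list. set xs \<subseteq> UNIV \<and> length xs = l})"
    unfolding eq by (rule card_UN_le) simp
  also have "\<dots> = (\<Sum>l<m. 2 ^ l)"
    by (subst card_lists_length_eq) auto
  also have "\<dots> < 2 ^ m"
    by (induction m) auto
  finally show "card {xs :: bool list. length xs < m} < 2 ^ m" .
qed

text \<open>Pigeonhole: the stored string determines all answers, so graphs that differ in some
  answer need different strings, and fewer than \<open>2 ^ m\<close> strings are shorter than
  \<open>m\<close>.\<close>

lemma k_connectivity_oracle_space:
  assumes "2 ^ m \<le> card I" and V: "\<And>i. i \<in> I \<Longrightarrow> pverts (G i) = V"
    and sep: "\<And>i j. i \<in> I \<Longrightarrow> j \<in> I \<Longrightarrow> i \<noteq> j \<Longrightarrow>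
      \<exists>s\<in>V. \<exists>t\<in>V. s \<noteq> t \<and> (kappa (G i) s t > k) \<noteq> (kappa (G j) s t > k)"
  shows "\<exists>i\<in>I. \<forall>D. k_connectivity_oracle query k (G i) D \<longrightarrow> m \<le> length D"
proof (rule ccontr)
  assume "\<not> ?thesis"
  then obtain D where D: "\<And>i. i \<in> I \<Longrightarrow> k_connectivity_oracle query k (G i) (D i)"
      "\<And>i. i \<in> I \<Longrightarrow> length (D i) < m"
    by (metis not_le)
  have "inj_on D I"
  proof (rule inj_onI, rule ccontr)
    fix i j assume ij: "i \<in> I" "j \<in> I" "D i = D j" "i \<noteq> j"
    obtain s t where st: "s \<in> V" "t \<in> V" "s \<noteq> t" "(kappa (G i) s t > k) \<noteq> (kappa (G j) s t > k)"
      using sep ij by blast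
    have "query (D i) s t \<longleftrightarrow> kappa (G i) s t > k" "query (D j) s t \<longleftrightarrow> kappa (G j) s t > k"
      using D(1) V ij(1,2) st(1-3) unfolding k_connectivity_oracle_def by blast+
    then show False
      using st(4) ij(3) by simp
  qed
  then have "card I \<le> card {xs :: bool list. length xs < m}"
    using D(2) card_short_bool_lists(1) by (intro card_inj_on_le[of D]) auto
  then show False
    using assms(1) card_short_bool_lists(2)[of m] by linarith
qed

section \<open>Preorders\<close>

definition preorders :: "'a set \<Rightarrow> 'a rel set" where
  "preorders A = {R. R \<subseteq> A \<times> A \<and> refl_on A R \<and> trans R}"

lemma finite_preorders: "finite A \<Longrightarrow> finite (preorders A)"
  by (rule finite_subset[of _ "Pow (A \<times> A)"]) (auto simp: preorders_def)

text \<open>All pairs in \<open>T\<close> go from \<open>A\<close> to \<open>B\<close>, so no two of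
  them compose and transitivity is automatic.\<close>

lemma preorders_bipartite:
  assumes "A \<inter> B = {}" "A \<union> B \<subseteq> K" "T \<subseteq> A \<times> B"
  shows "Id_on K \<union> T \<in> preorders K"
  using assms by (auto simp: preorders_def refl_on_def trans_def)

text \<open>Relations from \<open>A\<close> to \<open>B\<close> and relations from \<open>B\<close>
  to \<open>A\<close> share only the empty one, which gives
  \<open>2 ^ (card A * card B + 1) - 1\<close> preorders; the full relation on \<open>K\<close> is
  the missing one.\<close>

lemma two_power_le_card_preorders:
  assumes "finite K" "A \<inter> B = {}" "A \<union> B \<subseteq> K" "A \<noteq> {}" "B \<noteq> {}"
  shows "2 ^ (card A * card B + 1) \<le> card (preorders K)"
proof -
  let ?F = "Pow (A \<times> B)" and ?G = "Pow (B \<times> A)"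
  let ?f = "\<lambda>T. Id_on K \<union> T"
  have fin: "finite A" "finite B"
    using assms finite_subset by auto
  have inj: "inj_on ?f (?F \<union> ?G)"
  proof (rule inj_on_inverseI)
    fix T assume "T \<in> ?F \<union> ?G"
    then show "?f T - Id_on K = T"
      using assms(2) by auto
  qed
  have "?F \<inter> ?G = {{}}"
    using assms(2) by auto
  then have "card (?F \<union> ?G) = 2 ^ (card A * card B) + 2 ^ (card A * card B) - 1"
    using card_Un_Int[of ?F ?G] fin by (simp add: card_Pow card_cartesian_product mult.commute)
  then have 1: "card (?f ` (?F \<union> ?G)) = 2 ^ (card A * card B + 1) - 1"
    using card_image[OF inj] by simp
  have "K \<times> K \<notin> ?f ` (?F \<union> ?G)"
  proof
    assume "K \<times> K \<in> ?f ` (?F \<union> ?G)"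
    then obtain T where T: "T \<in> ?F \<union> ?G" "K \<times> K = Id_on K \<union> T"
      by blast
    obtain a b where ab: "a \<in> A" "b \<in> B"
      using assms by blast
    then have "(a, b) \<in> K \<times> K" "(b, a) \<in> K \<times> K"
      using assms(3) by auto
    then have "(a, b) \<in> T" "(b, a) \<in> T"
      unfolding T(2) using ab assms(2) by auto
    then show False
      using T(1) ab assms(2) by auto
  qed
  then have "card (insert (K \<times> K) (?f ` (?F \<union> ?G))) = 2 ^ (card A * card B + 1)"
    using 1 fin by (subst card_insert_disjoint) auto
  moreover have "insert (K \<times> K) (?f ` (?F \<union> ?G)) \<subseteq> preorders K"
    using preorders_bipartite[of A B K] preorders_bipartite[of B A K] assms(2,3)
    by (auto simp: preorders_def refl_on_def trans_def)
  ultimately show ?thesis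
    using card_mono[OF finite_preorders[OF assms(1)]] by metis
qed

text \<open>Both halves are nonempty as \<open>2 \<le> k\<close>. For odd \<open>k\<close> the
  product of their sizes is \<open>(k^2 - 1) / 4\<close>, and the extra 1 in the exponent covers the
  deficit.\<close>

lemma square_le_card_preorders:
  assumes "2 \<le> k"
  obtains m where "real k ^ 2 / 4 \<le> real m" "2 ^ m \<le> card (preorders {..<k})"
proof -
  let ?h = "k div 2"
  have "2 ^ (card {..<?h} * card {?h..<k} + 1) \<le> card (preorders {..<k})"
    using assms by (intro two_power_le_card_preorders) (auto simp: lessThan_empty_iff)
  moreover have "real k ^ 2 / 4 \<le> real (card {..<?h} * card {?h..<k} + 1)"
  proof (cases "even k")
    case True
    then obtain h where "k = 2 * h" by blast
    then show ?thesis by (simp add: power2_eq_square)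
  next
    case False
    then obtain h where "k = 2 * h + 1" using oddE by blast
    then show ?thesis by (simp add: power2_eq_square algebra_simps)
  qed
  ultimately show ?thesis
    using that by blast
qed

section \<open>The block graph\<close>

text \<open>\<open>w r\<close> is the width of row \<open>r\<close>. Since \<open>R r\<close>
  relates only columns below \<open>k\<close>, surplus nodes have neighbours in their own row
  only.\<close>

locale block_graph =
  fixes k p :: nat and w :: "nat \<Rightarrow> nat" and R :: "nat \<Rightarrow> nat rel"
  assumes p: "1 \<le> p" and w0: "w 0 = k" and w: "\<And>r. r \<le> p \<Longrightarrow> k \<le> w r"
    and R: "\<And>r. 1 \<le> r \<Longrightarrow> r \<le> p \<Longrightarrow> R r \<in> preorders {..<k}"
begin

definition V :: "(nat \<times> nat) set" where
  "V = Sigma {..p} (\<lambda>r. {..<w r})"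

definition adj :: "nat \<times> nat \<Rightarrow> nat \<times> nat \<Rightarrow> bool" where
  "adj u v \<longleftrightarrow> fst u = fst v \<and> snd u \<noteq> snd v
     \<or> fst u \<noteq> 0 \<and> fst v = 0 \<and> (snd u, snd v) \<in> R (fst u)
     \<or> fst u = 0 \<and> fst v \<noteq> 0 \<and> (snd v, snd u) \<in> R (fst v)"

definition G :: "(nat \<times> nat) pair_pre_digraph" where
  "G = \<lparr>pverts = V, parcs = {(u, v). u \<in> V \<and> v \<in> V \<and> adj u v}\<rparr>"

lemma G_simps [simp]: "pverts G = V" "parcs G = {(u, v). u \<in> V \<and> v \<in> V \<and> adj u v}"
  by (simp_all add: G_def)

lemma finite_V [simp]: "finite V"
  by (simp add: V_def)

lemma pair_graph_G: "pair_graph G"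
  by (rule pair_graphI) (auto simp: sym_def irrefl_def adj_def)

lemma column_in_V [simp]: "r \<le> p \<Longrightarrow> l < k \<Longrightarrow> (r, l) \<in> V"
  using w[of r] by (simp add: V_def)

lemma adj_row [simp]: "adj (r, i) (r, j) \<longleftrightarrow> i \<noteq> j"
  by (auto simp: adj_def)

lemma adj_up [simp]: "1 \<le> r \<Longrightarrow> adj (r, i) (0, j) \<longleftrightarrow> (i, j) \<in> R r"
  by (simp add: adj_def)

lemma adj_down [simp]: "1 \<le> r \<Longrightarrow> adj (0, j) (r, i) \<longleftrightarrow> (i, j) \<in> R r"
  by (simp add: adj_def)

lemma R_refl [simp]: "1 \<le> r \<Longrightarrow> r \<le> p \<Longrightarrow> l < k \<Longrightarrow> (l, l) \<in> R r"
  using R[of r] by (auto simp: preorders_def refl_on_def)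

text \<open>The clique gives the direct arc and a path through each other column. If
  \<open>i\<close> and \<open>j\<close> are both below \<open>k\<close>, the columns below
  \<open>k\<close> yield only \<open>k - 1\<close> paths in this way, and one more runs through
  another row. Otherwise they yield \<open>k\<close>.\<close>

lemma kappa_same_row:
  assumes "(r, i) \<in> V" "(r, j) \<in> V" "i \<noteq> j"
  shows "k \<le> kappa G (r, i) (r, j)"
proof -
  have r: "r \<le> p"
    using assms by (simp add: V_def)
  show ?thesis
  proof (cases "i < k \<and> j < k")
    case True
    \<comment> \<open>Row 0 is joined to every other row, and row 1 exists because
      \<open>1 \<le> p\<close>.\<close>
    define r' :: nat where "r' = (if r = 0 then 1 else 0)"
    let ?q = "\<lambda>l. if l = i then [] else if l = j then [(r', i), (r', j)] else [(r, l)]"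
    show ?thesis
    proof (rule le_kappaI[where I = "{..<k}" and q = ?q])
      fix l assume "l \<in> {..<k}"
      then show "vpath ((r, i) # ?q l @ [(r, j)]) (with_proj G)"
        using True assms r p by (auto simp: vpath_def r'_def)
    qed (use True assms in \<open>auto simp: r'_def\<close>)
  next
    case False
    let ?q = "\<lambda>l. if l = i \<or> l = j then [] else [(r, l)]"
    show ?thesis
    proof (rule le_kappaI[where I = "{..<k}" and q = ?q])
      fix l assume "l \<in> {..<k}"
      then show "vpath ((r, i) # ?q l @ [(r, j)]) (with_proj G)"
        using assms r by (auto simp: vpath_def)
    qed (use False assms in auto)
  qed
qed

text \<open>Inner vertices of the path that moves to column \<open>l\<close> within the row of
  \<open>s\<close>, changes rows there, via row 0 if needed, and moves to \<open>t\<close> within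
  its row. The filter drops nodes that coincide with an end, as happens when \<open>l\<close> is the
  column of \<open>s\<close> or \<open>t\<close>.\<close>

definition column_path :: "nat \<times> nat \<Rightarrow> nat \<times> nat \<Rightarrow> nat \<Rightarrow> (nat \<times> nat) list" where
  "column_path s t l = filter (\<lambda>x. x \<noteq> s \<and> x \<noteq> t)
     (if fst s = 0 \<or> fst t = 0 then [(fst s, l), (fst t, l)] else [(fst s, l), (0, l), (fst t, l)])"

lemma vpath_column_path:
  assumes "s \<in> V" "t \<in> V" "fst s \<noteq> fst t" "l < k"
  shows "vpath (s # column_path s t l @ [t]) (with_proj G)"
proof -
  obtain r i r' j where st: "s = (r, i)" "t = (r', j)"
    by fastforce
  have "r \<le> p" "r' \<le> p"
    using assms st by (auto simp: V_def)
  then show ?thesis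
    using assms unfolding st column_path_def vpath_def
    by (cases "r = 0"; cases "r' = 0"; cases "l = i"; cases "l = j") auto
qed

lemma set_column_path: "x \<in> set (column_path s t l) \<Longrightarrow> snd x = l"
  by (auto simp: column_path_def split: if_splits)

lemma column_path_eq_Nil: "fst s \<noteq> fst t \<Longrightarrow> column_path s t l = [] \<Longrightarrow> snd s = l \<and> snd t = l"
  by (cases s; cases t) (auto simp: column_path_def split: if_splits)

text \<open>Paths in different columns are disjoint; if two were equal, both would be empty, which
  puts \<open>s\<close> into both columns.\<close>

lemma kappa_different_rows:
  assumes "s \<in> V" "t \<in> V" "fst s \<noteq> fst t"
  shows "k \<le> kappa G s t"
proof (rule le_kappaI[where I = "{..<k}" and q = "column_path s t"])
  fix i j :: nat assume ij: "i \<noteq> j"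
  show disj: "set (column_path s t i) \<inter> set (column_path s t j) = {}"
    using ij set_column_path by blast
  show "column_path s t i \<noteq> column_path s t j"
    using disj ij column_path_eq_Nil[OF assms(3)] by (metis Int_absorb set_empty)
qed (use vpath_column_path assms in auto)

lemma k_connected_G: "k_connected k G"
  unfolding k_connected_def
proof (intro ballI impI)
  fix s t assume "s \<in> pverts G" "t \<in> pverts G" "s \<noteq> t"
  then show "k \<le> kappa G s t"
    using kappa_same_row kappa_different_rows by (cases s; cases t) fastforce
qed

text \<open>As \<open>i \<noteq> j\<close>, each of the \<open>k\<close> column paths has an inner
  vertex, so the arc given by \<open>R r\<close> is one path more.\<close>

lemma kappa_related:
  assumes r: "1 \<le> r" "r \<le> p" and ij: "i < k" "j < k" "i \<noteq> j" "(i, j) \<in> R r"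
  shows "k < kappa G (r, i) (0, j)"
proof -
  let ?c = "column_path (r, i) (0, j)"
  \<comment> \<open>Index \<open>k\<close>, which is not a column of row 0, stands for the direct
    arc.\<close>
  let ?q = "\<lambda>l. if l = k then [] else ?c l"
  have nonempty: "?c l \<noteq> []" for l
    using column_path_eq_Nil[of "(r, i)" "(0, j)" l] r ij(3) by auto
  have disj: "set (?c l) \<inter> set (?c l') = {}" if "l \<noteq> l'" for l l'
    using that set_column_path by blast
  have "Suc k \<le> kappa G (r, i) (0, j)"
  proof (rule le_kappaI[where I = "{..k}" and q = ?q])
    fix l assume "l \<in> {..k}"
    then show "vpath ((r, i) # ?q l @ [(0, j)]) (with_proj G)"
      using vpath_column_path[of "(r, i)" "(0, j)" l] r ij by (auto simp: vpath_def)
  next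
    fix l l' assume "l \<in> {..k}" "l' \<in> {..k}" "l \<noteq> l'"
    then show "?q l \<noteq> ?q l'"
      using disj[of l l'] nonempty by (auto, metis Int_absorb set_empty)
  qed (use disj in auto)
  then show ?thesis by simp
qed

text \<open>The cut consists of the predecessors of \<open>j\<close> in row \<open>r\<close> and the non-predecessors in row \<open>0\<close>.\<close>

lemma kappa_unrelated:
  assumes r: "1 \<le> r" "r \<le> p" and ij: "i < k" "j < k" "(i, j) \<notin> R r"
  shows "kappa G (r, i) (0, j) \<le> k"
proof -
  define U where "U = {m. (m, j) \<in> R r}"
  define W where "W = Pair r ` U \<union> Pair 0 ` ({..<k} - U)"
  have pre: "R r \<subseteq> {..<k} \<times> {..<k}" "trans (R r)"
    using R[OF r] by (auto simp: preorders_def)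
  \<comment> \<open>By reflexivity \<open>j\<close> is in \<open>U\<close>, so the target avoids
    \<open>W\<close>; \<open>i\<close> is outside \<open>U\<close>, so the source lies on the side
    cut off.\<close>
  have U: "U \<subseteq> {..<k}" "finite U" "j \<in> U" "i \<notin> U"
    using pre(1) r ij finite_subset[of U "{..<k}"] by (auto simp: U_def)
  have "kappa G (r, i) (0, j) \<le> card W"
  proof (rule kappa_le_cut[where C = "Pair r ` (- U)"])
    fix u v assume uv: "(u, v) \<in> parcs G" "u \<in> Pair r ` (- U)"
    obtain m r' l where ml: "u = (r, m)" "v = (r', l)" "m \<notin> U"
      using uv(2) by (cases v) auto
    have "r' = r \<or> r' = 0 \<and> (m, l) \<in> R r"
      using uv(1) r unfolding ml by (auto simp: adj_def)
    \<comment> \<open>Transitivity: \<open>(l, j) \<in> R r\<close> would give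
      \<open>(m, j) \<in> R r\<close>, against \<open>m \<notin> U\<close>.\<close>
    moreover have "l \<notin> U \<and> l < k" if "(m, l) \<in> R r"
      using that pre ml(3) by (auto simp: U_def dest: transD)
    ultimately show "v \<in> Pair r ` (- U) \<union> W"
      unfolding W_def ml by auto
  qed (use U r ij in \<open>auto simp: W_def\<close>)
  \<comment> \<open>Each column below \<open>k\<close> contributes one node to \<open>W\<close>,
    either in row \<open>r\<close> or in row 0.\<close>
  also have "card W \<le> card U + card ({..<k} - U)"
    unfolding W_def by (rule order_trans[OF card_Un_le]) (simp add: card_image inj_on_def)
  also have "\<dots> = k"
    using U(1,2) card_mono[OF _ U(1)] by (simp add: card_Diff_subset)
  finally show ?thesis .
qed

lemma kappa_iff_related:
  assumes "1 \<le> r" "r \<le> p" "i < k" "j < k" "i \<noteq> j"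
  shows "k < kappa G (r, i) (0, j) \<longleftrightarrow> (i, j) \<in> R r"
  using kappa_related[OF assms] kappa_unrelated[OF assms(1-4)] by fastforce

end

section \<open>Space bound from block graphs\<close>

lemma oracle_space_block:
  fixes query :: "bool list \<Rightarrow> nat \<Rightarrow> nat \<Rightarrow> bool"
  assumes k: "2 \<le> k" and p: "1 \<le> p" and n: "k * (p + 1) \<le> n"
  shows "\<exists>G. pair_graph G \<and> pverts G = {..<n} \<and> k_connected k G \<and>
    (\<forall>D. k_connectivity_oracle query k G D \<longrightarrow> real p * (real k ^ 2 / 4) \<le> real (length D))"
proof -
  obtain m where m: "real k ^ 2 / 4 \<le> real m" "2 ^ m \<le> card (preorders {..<k})"
    using square_le_card_preorders[OF k] .
  \<comment> \<open>The last row takes the surplus. It has at least \<open>k\<close> nodes by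
    \<open>n\<close>, and row 0 keeps exactly \<open>k\<close> as \<open>1 \<le> p\<close>.\<close>
  define w where "w r = (if r = p then n - k * p else k)" for r
  \<comment> \<open>Extensional functions, so that distinct members differ in some row from 1 to
    \<open>p\<close>.\<close>
  define I where "I = PiE {1..p} (\<lambda>_. preorders {..<k})"
  have card_I: "2 ^ (p * m) \<le> card I"
  proof -
    have "2 ^ (p * m) = (2 ^ m :: nat) ^ p"
      by (simp only: power_mult[symmetric] mult.commute)
    also have "\<dots> \<le> card (preorders {..<k}) ^ p"
      using m(2) by (rule power_mono) simp
    also have "\<dots> = card I"
      by (simp add: I_def card_PiE)
    finally show ?thesis .
  qed
  have bg: "block_graph k p w R" if "R \<in> I" for R
  proof
    show "k \<le> w r" for r
      using n by (auto simp: w_def)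
    show "R r \<in> preorders {..<k}" if "1 \<le> r" "r \<le> p" for r
      using that \<open>R \<in> I\<close> by (auto simp: I_def)
  qed (use p in \<open>auto simp: w_def\<close>)
  let ?V = "Sigma {..p} (\<lambda>r. {..<w r})"
  have "card ?V = n"
  proof -
    have "card ?V = (\<Sum>r\<le>p. w r)"
      by simp
    also have "\<dots> = (\<Sum>r<p. w r) + w p"
      by (simp add: lessThan_Suc_atMost[symmetric])
    also have "(\<Sum>r<p. w r) = k * p"
      by (simp add: w_def)
    finally show ?thesis
      using n by (simp add: w_def)
  qed
  \<comment> \<open>The node set does not depend on \<open>R\<close>, so one labelling serves the
    whole family and a query names the same nodes in every graph.\<close>
  then obtain f where f: "bij_betw f ?V {..<n}"
    using finite_same_card_bij[of ?V "{..<n}"] by auto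
  define H where "H R = block_graph.G p w R" for R
  have G: "pair_graph (H R)" "pverts (H R) = ?V" "k_connected k (H R)" if "R \<in> I" for R
  proof -
    interpret block_graph k p w R using bg that .
    show "pair_graph (H R)" "pverts (H R) = ?V" "k_connected k (H R)"
      by (simp_all add: H_def pair_graph_G k_connected_G V_def)
  qed
  have inj: "inj_on f ?V" and im: "f ` ?V = {..<n}"
    using f by (auto simp: bij_betw_def)
  have kappa: "kappa (relabel f (H R)) (f s) (f t) = kappa (H R) s t"
    if "R \<in> I" "s \<in> ?V" "t \<in> ?V" for R s t
    using kappa_relabel[OF G(1)] G(2) that inj by metis
  have "\<exists>R\<in>I. \<forall>D. k_connectivity_oracle query k (relabel f (H R)) D \<longrightarrow> p * m \<le> length D"
  proof (rule k_connectivity_oracle_space[OF card_I])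
    show "pverts (relabel f (H R)) = {..<n}" if "R \<in> I" for R
      using G(2) that im by simp
  next
    fix R S assume RS: "R \<in> I" "S \<in> I" "R \<noteq> S"
    then obtain r where r: "1 \<le> r" "r \<le> p" "R r \<noteq> S r"
      unfolding I_def by (metis PiE_ext atLeastAtMost_iff)
    obtain i j where ij: "((i, j) \<in> R r) \<noteq> ((i, j) \<in> S r)"
      using r(3) by auto
    have pre: "R r \<in> preorders {..<k}" "S r \<in> preorders {..<k}"
      using RS r by (auto simp: I_def)
    \<comment> \<open>Both relations are reflexive, so they differ only off the diagonal.\<close>
    then have *: "i < k" "j < k" "i \<noteq> j"
      using ij by (auto simp: preorders_def refl_on_def)
    interpret R: block_graph k p w R using bg RS(1) .
    interpret S: block_graph k p w S using bg RS(2) .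
    have V: "(r, i) \<in> ?V" "(0, j) \<in> ?V"
      using R.column_in_V[of r i] R.column_in_V[of 0 j] r * by (auto simp: R.V_def)
    have "f (r, i) \<noteq> f (0, j)"
      using inj V r by (auto dest: inj_onD)
    moreover have "(kappa (H R) (r, i) (0, j) > k) \<noteq> (kappa (H S) (r, i) (0, j) > k)"
      unfolding H_def using R.kappa_iff_related S.kappa_iff_related r * ij by simp
    ultimately show "\<exists>s\<in>{..<n}. \<exists>t\<in>{..<n}. s \<noteq> t \<and>
        (kappa (relabel f (H R)) s t > k) \<noteq> (kappa (relabel f (H S)) s t > k)"
      using V im kappa RS by (metis image_eqI)
  qed
  then obtain R where R: "R \<in> I"
      "\<And>D. k_connectivity_oracle query k (relabel f (H R)) D \<Longrightarrow> p * m \<le> length D"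
    by blast
  have "real p * (real k ^ 2 / 4) \<le> real (p * m)"
    unfolding of_nat_mult using m(1) by (intro mult_left_mono) auto
  then have "\<forall>D. k_connectivity_oracle query k (relabel f (H R)) D \<longrightarrow>
      real p * (real k ^ 2 / 4) \<le> real (length D)"
    using R(2) by (meson of_nat_le_iff order_trans)
  moreover have "k_connected k (relabel f (H R))"
    unfolding k_connected_def relabel_simps G(2)[OF R(1)]
  proof (intro ballI impI)
    fix s t assume "s \<in> f ` ?V" "t \<in> f ` ?V" "s \<noteq> t"
    then obtain x y where xy: "s = f x" "t = f y" "x \<in> ?V" "y \<in> ?V" "x \<noteq> y"
      by blast
    then have "k \<le> kappa (H R) x y"
      using G(2,3)[OF R(1)] unfolding k_connected_def by metis
    then show "k \<le> kappa (relabel f (H R)) s t"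
      using kappa[OF R(1) xy(3,4)] xy(1,2) by simp
  qed
  ultimately show ?thesis
    using pair_graph_relabel[OF G(1)[OF R(1)]] G(2)[OF R(1)] inj im by (metis relabel_simps(1))
qed

section \<open>Fans of triangles\<close>

text \<open>A single point carries just one preorder, so block graphs encode nothing for
  \<open>k = 1\<close>. Here \<open>T\<close> selects which pairs of leaves of a star with centre 0
  are joined, each forming a triangle with the centre.\<close>

definition fan :: "nat \<Rightarrow> nat set \<Rightarrow> nat pair_pre_digraph" where
  "fan n T = \<lparr>pverts = {..<n}, parcs = {(u, v). u < n \<and> v < n \<and> u \<noteq> v \<and>
     (u = 0 \<or> v = 0 \<or> (\<exists>i\<in>T. {u, v} = {2 * i + 1, 2 * i + 2}))}\<rparr>"

lemma fan_simps [simp]: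
  "pverts (fan n T) = {..<n}"
  "(u, v) \<in> parcs (fan n T) \<longleftrightarrow> u < n \<and> v < n \<and> u \<noteq> v \<and>
     (u = 0 \<or> v = 0 \<or> (\<exists>i\<in>T. {u, v} = {2 * i + 1, 2 * i + 2}))"
  by (simp_all add: fan_def)

lemma pair_graph_fan: "pair_graph (fan n T)"
  by (rule pair_graphI) (auto simp: fan_def sym_def irrefl_def insert_commute)

lemma k_connected_fan: "k_connected 1 (fan n T)"
  unfolding k_connected_def
proof (intro ballI impI)
  fix s t assume "s \<in> pverts (fan n T)" "t \<in> pverts (fan n T)" "s \<noteq> t"
  then have "vpath (s # (if s = 0 \<or> t = 0 then [] else [0]) @ [t]) (with_proj (fan n T))"
    by (auto simp: vpath_def)
  then show "1 \<le> kappa (fan n T) s t"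
    by (intro le_kappaI[where I = "{()}"]) simp_all
qed

text \<open>One path runs through the centre, and the arc, if present, is a second; without it the
  centre alone cuts off the first leaf.\<close>

lemma kappa_fan:
  assumes "2 * i + 2 < n"
  shows "1 < kappa (fan n T) (2 * i + 1) (2 * i + 2) \<longleftrightarrow> i \<in> T"
proof
  let ?q = "\<lambda>b. if b then [] else [0]"
  assume "i \<in> T"
  then have "vpath ((2 * i + 1) # ?q b @ [2 * i + 2]) (with_proj (fan n T))" for b
    using assms by (auto simp: vpath_def)
  then have "2 \<le> kappa (fan n T) (2 * i + 1) (2 * i + 2)"
    by (intro le_kappaI[where I = UNIV and q = ?q]) (simp_all split: if_splits)
  then show "1 < kappa (fan n T) (2 * i + 1) (2 * i + 2)"
    by simp
next
  have "kappa (fan n T) (2 * i + 1) (2 * i + 2) \<le> card {0 :: nat}" if "i \<notin> T"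
  proof (rule kappa_le_cut[where C = "{2 * i + 1}"])
    fix u v assume "(u, v) \<in> parcs (fan n T)" "u \<in> {2 * i + 1}"
    \<comment> \<open>By parity \<open>2 * i + 1\<close> can only be the first leaf of a pair, hence
      lies in pair \<open>i\<close> alone.\<close>
    moreover have "2 * i + 1 \<noteq> 2 * j + 2" for j by presburger
    ultimately show "v \<in> {2 * i + 1} \<union> {0}"
      using that by (auto simp: doubleton_eq_iff)
  qed auto
  moreover assume "1 < kappa (fan n T) (2 * i + 1) (2 * i + 2)"
  ultimately show "i \<in> T" by fastforce
qed

text \<open>The \<open>n - 1\<close> leaves contain \<open>(n - 1) div 2\<close> disjoint pairs, and
  each pair encodes one bit.\<close>

lemma oracle_space_fan:
  "\<exists>G. pair_graph G \<and> pverts G = {..<n} \<and> k_connected 1 G \<and>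
    (\<forall>D. k_connectivity_oracle query 1 G D \<longrightarrow> (n - 1) div 2 \<le> length D)"
proof -
  let ?I = "Pow {..<(n - 1) div 2}"
  have "\<exists>T\<in>?I. \<forall>D. k_connectivity_oracle query 1 (fan n T) D \<longrightarrow> (n - 1) div 2 \<le> length D"
  proof (rule k_connectivity_oracle_space)
    fix S T assume "S \<in> ?I" "T \<in> ?I" "S \<noteq> T"
    then obtain i where i: "(i \<in> S) \<noteq> (i \<in> T)" "i < (n - 1) div 2"
      by blast
    then have n: "2 * i + 2 < n" by linarith
    show "\<exists>s\<in>{..<n}. \<exists>t\<in>{..<n}. s \<noteq> t \<and> (1 < kappa (fan n S) s t) \<noteq> (1 < kappa (fan n T) s t)"
      by (rule bexI[of _ "2 * i + 1"], rule bexI[of _ "2 * i + 2"])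
        (use n i(1) kappa_fan[OF n] in auto)
  qed (auto simp: card_Pow)
  then show ?thesis
    using pair_graph_fan k_connected_fan fan_simps(1) by meson
qed

section \<open>The bound linear in \<open>k * n\<close>\<close>

lemma oracle_space_linear:
  assumes "1 \<le> k" "2 * k < n"
  shows "\<exists>G. pair_graph G \<and> pverts G = {..<n} \<and> k_connected k G \<and>
    (\<forall>D. k_connectivity_oracle query k G D \<longrightarrow> 1 / 12 * (real k * real n) \<le> real (length D))"
proof (cases "k = 1")
  case True
  have "n \<le> 12 * ((n - 1) div 2)"
    using assms True by linarith
  then have "real n \<le> 12 * real ((n - 1) div 2)"
    by (metis of_nat_le_iff of_nat_mult of_nat_numeral)
  then have "1 / 12 * (real k * real n) \<le> real ((n - 1) div 2)"
    using True by simp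
  then show ?thesis
    using oracle_space_fan[of n query] True by (meson of_nat_le_iff order_trans)
next
  case False
  \<comment> \<open>\<open>k * (p + 1)\<close> is the largest multiple of \<open>k\<close> up to
    \<open>n\<close>, and \<open>2 * k < n\<close> ensures \<open>1 \<le> p\<close>.\<close>
  define p where "p = n div k - 1"
  have "2 \<le> n div k"
    using assms by (simp add: less_eq_div_iff_mult_less_eq)
  then have p: "1 \<le> p" "p + 1 = n div k"
    by (auto simp: p_def)
  have "n < k * (p + 1) + k"
    using assms(1) mult_div_mod_eq[of k n] mod_less_divisor[of k n] p(2) by (metis add_strict_left_mono less_le_trans zero_less_one)
  then have "n < k * p + 2 * k"
    by (simp add: algebra_simps)
  moreover have "k \<le> k * p"
    using p(1) by simp
  \<comment> \<open>This factor 3 and the 1/4 of the block bound make up the constant 1/12.\<close>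
  ultimately have "n \<le> 3 * (k * p)"
    by linarith
  then have "real n \<le> 3 * (real k * real p)"
    by (metis of_nat_le_iff of_nat_mult of_nat_numeral)
  then have "1 / 12 * (real k * real n) \<le> 1 / 12 * (real k * (3 * (real k * real p)))"
    by (intro mult_left_mono) auto
  also have "\<dots> = real p * (real k ^ 2 / 4)"
    by (simp add: power2_eq_square)
  finally have le: "1 / 12 * (real k * real n) \<le> real p * (real k ^ 2 / 4)" .
  have "k * (p + 1) \<le> n"
    by (simp only: p(2) times_div_less_eq_dividend)
  then show ?thesis
    using oracle_space_block[of k p n query] False assms(1) p(1) le
    by (metis One_nat_def Suc_leI le_neq_implies_less numeral_2_eq_2 order_trans)
qed

theorem theorem1:
  shows
    "(\<forall>(k::nat) (p::nat) (n::nat).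
        2 \<le> k \<longrightarrow> 1 \<le> p \<longrightarrow> real p \<le> 2 powr (real k ^ 2 / 4) \<longrightarrow> n = k * (p + 1) \<longrightarrow>
        real p * (real k ^ 2 / 4) = (1 - 1 / (real p + 1)) * (real k * real n / 4) \<and>
        (\<forall>query :: bool list \<Rightarrow> nat \<Rightarrow> nat \<Rightarrow> bool.
           \<exists>G :: nat pair_pre_digraph.
             pair_graph G \<and> pverts G = {..<n} \<and> k_connected k G \<and>
             (\<forall>D. k_connectivity_oracle query k G D \<longrightarrow>
                real (length D) \<ge> real p * (real k ^ 2 / 4))))
     \<and>
     (\<exists>c>0. \<forall>(k::nat) (n::nat). 1 \<le> k \<longrightarrow> 2 * k < n \<longrightarrow>
        (\<forall>query :: bool list \<Rightarrow> nat \<Rightarrow> nat \<Rightarrow> bool.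
           \<exists>G :: nat pair_pre_digraph.
             pair_graph G \<and> pverts G = {..<n} \<and> k_connected k G \<and>
             (\<forall>D. k_connectivity_oracle query k G D \<longrightarrow>
                real (length D) \<ge> c * (real k * real n))))"
proof (rule conjI)
  have "real p * (real k ^ 2 / 4) = (1 - 1 / (real p + 1)) * (real k * real (k * (p + 1)) / 4)"
    for k p :: nat
  proof -
    have "real p + 1 \<noteq> 0" by linarith
    then show ?thesis
      by (simp add: divide_simps power2_eq_square) (simp add: algebra_simps)
  qed
  then show "\<forall>(k::nat) (p::nat) (n::nat).
        2 \<le> k \<longrightarrow> 1 \<le> p \<longrightarrow> real p \<le> 2 powr (real k ^ 2 / 4) \<longrightarrow> n = k * (p + 1) \<longrightarrow>
        real p * (real k ^ 2 / 4) = (1 - 1 / (real p + 1)) * (real k * real n / 4) \<and>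
        (\<forall>query :: bool list \<Rightarrow> nat \<Rightarrow> nat \<Rightarrow> bool.
           \<exists>G :: nat pair_pre_digraph.
             pair_graph G \<and> pverts G = {..<n} \<and> k_connected k G \<and>
             (\<forall>D. k_connectivity_oracle query k G D \<longrightarrow>
                real (length D) \<ge> real p * (real k ^ 2 / 4)))"
    using oracle_space_block by (metis order_refl)
  show "\<exists>c>0. \<forall>(k::nat) (n::nat). 1 \<le> k \<longrightarrow> 2 * k < n \<longrightarrow>
        (\<forall>query :: bool list \<Rightarrow> nat \<Rightarrow> nat \<Rightarrow> bool.
           \<exists>G :: nat pair_pre_digraph.
             pair_graph G \<and> pverts G = {..<n} \<and> k_connected k G \<and>
             (\<forall>D. k_connectivity_oracle query k G D \<longrightarrow>
                real (length D) \<ge> c * (real k * real n)))"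
    using oracle_space_linear by (intro exI[of _ "1 / 12"]) auto
qed

end
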